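(* The graphs $G_{11,35}$, $G_{10,30}$ and $G_{10,26}$ (defined by the edge lists in the context) satisfy $\mu(G_{11,35})=\mu(G_{10,30})=\mu(G_{10,26})=5$, where $\mu$ denotes the Colin de Verdi\`ere graph invariant.
   Context: Colin de Verdi\`ere invariant: for a finite simple graph $G$ with vertex set $\{1,\dots,n\}$, $\mu(G)$ is the maximum corank of a real symmetric $n\times n$ matrix $M$ such that (i) for $i\neq j$, $M_{ij}<0$ if $i,j$ are adjacent and $M_{ij}=0$ otherwise (diagonal entries are arbitrary); (ii) $M$ has exactly one negative eigenvalue, of multiplicity $1$; (iii) there is no nonzero real symmetric $n\times n$ matrix $X$ with $MX=0$ and $X_{ij}=0$ whenever $i=j$ or $M_{ij}\neq 0$. $G_{11,35}$ has vertex set $\{1,\dots,11\}$ and edges $(1,2),(1,3),(1,4),(1,5),(1,8),(1,9),(2,3),(2,4),(2,8),(3,4),(3,5),(3,6),(3,7),(3,8),(3,10),(3,11),(4,5),(4,6),(4,8),(4,9),(4,10),(5,6),(5,7),(5,9),(5,10),(5,11),(6,7),(6,8),(6,9),(6,10),(6,11),(7,11),(8,9),(10,11),(2,11)$. $G_{10,30}$ has vertex set $\{1,\dots,10\}$ and edges $(1,5),(1,7),(1,8),(1,9),(1,10),(2,3),(2,4),(2,5),(2,6),(2,7),(2,10),(3,4),(3,6),(3,8),(3,9),(3,10),(4,6),(4,8),(4,9),(5,6),(5,7),(5,8),(5,10),(6,7),(6,8),(6,9),(7,9),(7,10),(8,10),(9,10)$. $G_{10,26}$ has vertex set $\{1,\dots,10\}$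 and edges $(1,2),(1,3),(1,4),(1,5),(1,8),(1,9),(2,4),(2,7),(2,8),(2,10),(3,4),(3,7),(3,8),(3,10),(4,5),(4,6),(4,8),(4,9),(5,7),(5,9),(5,10),(6,7),(6,8),(6,9),(6,10),(8,9)$. *)

theory Defs
  imports
    "Graph_Theory.Pair_Digraph"
    "Jordan_Normal_Form.Char_Poly"
    "Jordan_Normal_Form.Matrix_Kernel"
begin

text \<open>
  A finite simple graph is a \<^locale>\<open>pair_graph\<close>: finitely many vertices, no loops, and
  a symmetric set of arcs, each undirected edge contributing both of its orientations.
\<close>

definition graph_of_edges :: "nat \<Rightarrow> (nat \<times> nat) set \<Rightarrow> nat pair_pre_digraph" where
  "graph_of_edges n E = \<lparr>pverts = {1..n}, parcs = E \<union> E\<inverse>\<rparr>"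

lemma pverts_graph_of_edges: "pverts (graph_of_edges n E) = {1..n}"
  by (simp add: graph_of_edges_def)

lemma
  assumes E: "E \<subseteq> {(i, j). 1 \<le> i \<and> i < j \<and> j \<le> n}"
  shows pair_graph_of_edges: "pair_graph (graph_of_edges n E)"
    and card_parcs_graph_of_edges: "card (parcs (graph_of_edges n E)) = 2 * card E"
proof -
  have fin: "finite E"
    by (rule finite_subset[of _ "{..n} \<times> {..n}"]) (use E in auto)
  show "pair_graph (graph_of_edges n E)"
    by unfold_locales
      (use E fin in \<open>auto simp: graph_of_edges_def symmetric_def sym_Un_converse\<close>)
  have "E \<inter> E\<inverse> = {}"
    by (auto dest!: subsetD[OF E])
  then show "card (parcs (graph_of_edges n E)) = 2 * card E"
    using fin by (simp add: graph_of_edges_def card_Un_disjoint)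
qed

text \<open>
  Matrices are indexed from 0 while the vertices are \<open>1, \<dots>, n\<close>, so row and column \<open>i\<close>
  belong to vertex \<open>i + 1\<close>.
\<close>

definition cdv_pattern :: "nat pair_pre_digraph \<Rightarrow> nat \<Rightarrow> real mat \<Rightarrow> bool" where
  "cdv_pattern G n M \<longleftrightarrow>
     (\<forall>i<n. \<forall>j<n. i \<noteq> j \<longrightarrow>
        (if (i + 1, j + 1) \<in> parcs G then M $$ (i, j) < 0 else M $$ (i, j) = 0))"

text \<open>
  The multiplicity is the algebraic one; for the real symmetric matrices considered here it
  agrees with the geometric one.
\<close>

definition one_negative_eigenvalue :: "real mat \<Rightarrow> bool" where
  "one_negative_eigenvalue M \<longleftrightarrow>
     (\<exists>e. {k. eigenvalue M k \<and> k < 0} = {e} \<and> Polynomial.order e (char_poly M) = 1)"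

definition strong_arnold :: "nat \<Rightarrow> real mat \<Rightarrow> bool" where
  "strong_arnold n M \<longleftrightarrow>
     \<not> (\<exists>X \<in> carrier_mat n n. X \<noteq> 0\<^sub>m n n \<and> transpose_mat X = X \<and> M * X = 0\<^sub>m n n \<and>
          (\<forall>i<n. \<forall>j<n. i = j \<or> M $$ (i, j) \<noteq> 0 \<longrightarrow> X $$ (i, j) = 0))"

definition cdv_matrices :: "nat pair_pre_digraph \<Rightarrow> real mat set" where
  "cdv_matrices G =
     (let n = card (pverts G) in
      {M \<in> carrier_mat n n. transpose_mat M = M \<and> cdv_pattern G n M \<and>
         one_negative_eigenvalue M \<and> strong_arnold n M})"

text \<open>
  The set of coranks is finite for every \<open>G\<close>, as shown below. For a finite nonempty graph it is
  also nonempty: off-diagonal entries \<open>-1\<close> on the edges, one diagonal entry very negative and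
  the others very large give an invertible matrix, for which the last condition is vacuous.
\<close>

definition colin_de_verdiere :: "nat pair_pre_digraph \<Rightarrow> nat" where
  "colin_de_verdiere G = Max (kernel_dim ` cdv_matrices G)"

lemma finite_cdv_coranks: "finite (kernel_dim ` cdv_matrices G)"
proof (rule finite_subset)
  show "kernel_dim ` cdv_matrices G \<subseteq> {..card (pverts G)}"
    by (auto simp: cdv_matrices_def Let_def kernel_dim_code)
qed simp

definition G_11_35 :: "nat pair_pre_digraph" where
  "G_11_35 = graph_of_edges 11
    {(1,2), (1,3), (1,4), (1,5), (1,8), (1,9), (2,3), (2,4), (2,8), (3,4), (3,5), (3,6),
     (3,7), (3,8), (3,10), (3,11), (4,5), (4,6), (4,8), (4,9), (4,10), (5,6), (5,7), (5,9),
     (5,10), (5,11), (6,7), (6,8), (6,9), (6,10), (6,11), (7,11), (8,9), (10,11), (2,11)}"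

definition G_10_30 :: "nat pair_pre_digraph" where
  "G_10_30 = graph_of_edges 10
    {(1,5), (1,7), (1,8), (1,9), (1,10), (2,3), (2,4), (2,5), (2,6), (2,7), (2,10), (3,4),
     (3,6), (3,8), (3,9), (3,10), (4,6), (4,8), (4,9), (5,6), (5,7), (5,8), (5,10), (6,7),
     (6,8), (6,9), (7,9), (7,10), (8,10), (9,10)}"

definition G_10_26 :: "nat pair_pre_digraph" where
  "G_10_26 = graph_of_edges 10
    {(1,2), (1,3), (1,4), (1,5), (1,8), (1,9), (2,4), (2,7), (2,8), (2,10), (3,4), (3,7),
     (3,8), (3,10), (4,5), (4,6), (4,8), (4,9), (5,7), (5,9), (5,10), (6,7), (6,8), (6,9),
     (6,10), (8,9)}"

lemma G_11_35_props:
  "pair_graph G_11_35" "card (pverts G_11_35) = 11" "card (parcs G_11_35) = 2 * 35"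
  unfolding G_11_35_def
  by (auto simp: pverts_graph_of_edges pair_graph_of_edges card_parcs_graph_of_edges)

lemma G_10_30_props:
  "pair_graph G_10_30" "card (pverts G_10_30) = 10" "card (parcs G_10_30) = 2 * 30"
  unfolding G_10_30_def
  by (auto simp: pverts_graph_of_edges pair_graph_of_edges card_parcs_graph_of_edges)

lemma G_10_26_props:
  "pair_graph G_10_26" "card (pverts G_10_26) = 10" "card (parcs G_10_26) = 2 * 26"
  unfolding G_10_26_def
  by (auto simp: pverts_graph_of_edges pair_graph_of_edges card_parcs_graph_of_edges)

end

theory Submission
  imports Defs
begin

text \<open>
  Upper bounds: if the corank were at least 6, then for any five vertices the kernel of \<open>M\<close>
  would contain a nonzero vector \<open>x\<close> vanishing there. Row \<open>v\<close> of \<open>M x = 0\<close> shows that the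
  neighbours of a vertex \<open>v\<close> with \<open>x\<^sub>v = 0\<close> carry either both signs or only zeros. For suitable
  five vertices this sign rule is contradictory in \<open>G\<^bsub>11,35\<^esub>\<close> and \<open>G\<^bsub>10,30\<^esub>\<close>. In \<open>G\<^bsub>10,26\<^esub>\<close> it leaves
  sign patterns that force a vanishing and a negative diagonal entry of \<open>M\<close>, from which one
  builds a negative definite plane; this is impossible with a single negative eigenvalue.

  Lower bounds: a Gram matrix of vectors spanning a space with a form of signature \<open>(n - 6, 1)\<close>
  has corank 5 and one negative eigenvalue, and the vectors can be chosen with small integer
  coordinates such that the signs of the entries match the graph.
\<close>

section \<open>Spectral theorem for real symmetric matrices\<close>

lemma scalar_prod_self_eq_0:
  fixes x :: "real vec"
  assumes "x \<in> carrier_vec n"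
  shows "x \<bullet> x = 0 \<longleftrightarrow> x = 0\<^sub>v n"
  using assms by (auto simp: scalar_prod_def sum_nonneg_eq_0_iff)

lemma scalar_prod_self_ge_0: "0 \<le> x \<bullet> x" for x :: "real vec"
  by (auto simp: scalar_prod_def intro: sum_nonneg)

text \<open>A complex root \<open>z\<close> of the characteristic polynomial has an eigenvector with
  real part \<open>x\<close> and imaginary part \<open>y\<close>. Symmetry equates the products of
  \<open>y\<close> with \<open>A x\<close> and of \<open>x\<close> with \<open>A y\<close>, which
  gives \<open>Im z * (x . x + y . y) = 0\<close>. So \<open>z\<close> is real, and whichever of
  \<open>x\<close>, \<open>y\<close> is nonzero is a real eigenvector.\<close>

lemma symmetric_real_eigenvector:
  fixes A :: "real mat"
  assumes A: "A \<in> carrier_mat n n" and sym: "transpose_mat A = A" and n: "0 < n"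
  obtains e v where "eigenvector A v e"
proof -
  let ?C = "map_mat complex_of_real A"
  have C: "?C \<in> carrier_mat n n" using A by simp
  have "degree (char_poly ?C) = n"
    using degree_monic_char_poly[OF C] by simp
  then have "\<not> constant (poly (char_poly ?C))"
    using n by (simp add: constant_degree)
  then obtain z where "poly (char_poly ?C) z = 0"
    using fundamental_theorem_of_algebra by blast
  then have "eigenvalue ?C z"
    using eigenvalue_root_char_poly[OF C] by simp
  then obtain w where w: "w \<in> carrier_vec n" "w \<noteq> 0\<^sub>v n" and Cw: "?C *\<^sub>v w = z \<cdot>\<^sub>v w"
    using C by (auto simp: eigenvalue_def eigenvector_def)
  define x where "x = map_vec Re w"
  define y where "y = map_vec Im w"
  have x: "x \<in> carrier_vec n" and y: "y \<in> carrier_vec n"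
    using w by (auto simp: x_def y_def)
  have entry: "(\<Sum>j<n. complex_of_real (A $$ (i, j)) * w $ j) = z * w $ i" if "i < n" for i
    using arg_cong[OF Cw, of "\<lambda>u. u $ i"] that w A
    by (simp add: scalar_prod_def atLeast0LessThan)
  have Ax: "A *\<^sub>v x = Re z \<cdot>\<^sub>v x - Im z \<cdot>\<^sub>v y"
  proof (rule eq_vecI)
    fix i assume "i < dim_vec (Re z \<cdot>\<^sub>v x - Im z \<cdot>\<^sub>v y)"
    then have i: "i < n" using y by simp
    show "(A *\<^sub>v x) $ i = (Re z \<cdot>\<^sub>v x - Im z \<cdot>\<^sub>v y) $ i"
      using arg_cong[OF entry[OF i], of Re] i A w
      by (simp add: scalar_prod_def atLeast0LessThan x_def y_def)
  qed (use A y in auto)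
  have Ay: "A *\<^sub>v y = Im z \<cdot>\<^sub>v x + Re z \<cdot>\<^sub>v y"
  proof (rule eq_vecI)
    fix i assume "i < dim_vec (Im z \<cdot>\<^sub>v x + Re z \<cdot>\<^sub>v y)"
    then have i: "i < n" using y by simp
    show "(A *\<^sub>v y) $ i = (Im z \<cdot>\<^sub>v x + Re z \<cdot>\<^sub>v y) $ i"
      using arg_cong[OF entry[OF i], of Im] i A w
      by (simp add: scalar_prod_def atLeast0LessThan x_def y_def)
  qed (use A y in auto)
  have "y \<bullet> (A *\<^sub>v x) = x \<bullet> (A *\<^sub>v y)"
    using transpose_vec_mult_scalar[OF A x y] sym comm_scalar_prod[OF y, of "A *\<^sub>v x"]
      comm_scalar_prod[OF x, of "A *\<^sub>v y"] A x y by simp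
  then have "Im z * (x \<bullet> x + y \<bullet> y) = 0"
    using comm_scalar_prod[OF x y] x y unfolding Ax Ay
    by (simp add: scalar_prod_minus_distrib[of _ n] scalar_prod_add_distrib[of _ n] algebra_simps)
  moreover have nz: "x \<noteq> 0\<^sub>v n \<or> y \<noteq> 0\<^sub>v n"
  proof (rule ccontr)
    assume "\<not> ?thesis"
    then have "w $ i = 0" if "i < n" for i
      using that w by (auto simp: x_def y_def vec_eq_iff complex_eq_iff)
    then show False using w by auto
  qed
  then have "x \<bullet> x + y \<bullet> y \<noteq> 0"
    using scalar_prod_self_ge_0[of x] scalar_prod_self_ge_0[of y] scalar_prod_self_eq_0[OF x]
      scalar_prod_self_eq_0[OF y] by linarith
  ultimately have Im: "Im z = 0" by simp
  show thesis
  proof (cases "x = 0\<^sub>v n")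
    case False
    then have "eigenvector A x (Re z)"
      using Ax x y A by (auto simp: eigenvector_def Im)
    then show thesis by (rule that)
  next
    case True
    then have "eigenvector A y (Re z)"
      using nz Ay x y A by (auto simp: eigenvector_def Im)
    then show thesis by (rule that)
  qed
qed

text \<open>The Householder reflection in the hyperplane orthogonal to
  \<open>v - unit_vec n 0\<close> exchanges the two unit vectors. If they coincide there is no such
  hyperplane, and the identity serves instead.\<close>

lemma reflection_to_unit_vec:
  fixes v :: "real vec"
  assumes v: "v \<in> carrier_vec n" and unit: "v \<bullet> v = 1" and n: "0 < n"
  obtains H where "H \<in> carrier_mat n n" "transpose_mat H = H" "H * H = 1\<^sub>m n"
    "H *\<^sub>v unit_vec n 0 = v"
proof (cases "v = unit_vec n 0")
  case True
  show thesis by (rule that[of "1\<^sub>m n"]) (use True in auto)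
next
  case False
  define w where "w i = v $ i - (if i = 0 then 1 else 0)" for i
  define c where "c = (\<Sum>i<n. w i ^ 2)"
  have sq: "(\<Sum>i<n. (v $ i)\<^sup>2) = 1"
    using unit v by (simp add: scalar_prod_def atLeast0LessThan power2_eq_square)
  \<comment> \<open>Here the unit length of \<open>v\<close> enters; this value of \<open>c\<close>
    is what makes column 0 of \<open>H\<close> equal to \<open>v\<close>.\<close>
  have c: "c = 2 - 2 * v $ 0"
  proof -
    have "c = (\<Sum>i<n. (v $ i)\<^sup>2 + (if i = 0 then 1 - 2 * v $ 0 else 0))"
      unfolding c_def w_def by (intro sum.cong) (auto simp: power2_eq_square algebra_simps)
    then show ?thesis using n by (simp add: sum.distrib sq)
  qed
  have "\<exists>i<n. w i \<noteq> 0"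
  proof (rule ccontr)
    assume "\<not> ?thesis"
    then have "v = unit_vec n 0" using v by (intro eq_vecI) (auto simp: w_def)
    with False show False by simp
  qed
  then have c0: "c \<noteq> 0"
    unfolding c_def by (subst sum_nonneg_eq_0_iff) auto
  define H where "H = mat n n (\<lambda>(i, j). (if i = j then 1 else 0) - 2 / c * w i * w j)"
  show thesis
  proof (rule that[of H])
    show "H \<in> carrier_mat n n" by (simp add: H_def)
    show "transpose_mat H = H" by (rule eq_matI) (auto simp: H_def)
    show "H * H = 1\<^sub>m n"
    proof (rule eq_matI)
      fix i j assume "i < dim_row (1\<^sub>m n)" "j < dim_col (1\<^sub>m n)"
      then have ij: "i < n" "j < n" by auto
      have "(H * H) $$ (i, j) = (\<Sum>k<n. ((if i = k then 1 else 0) - 2 / c * w i * w k) *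
          ((if k = j then 1 else 0) - 2 / c * w k * w j))"
        using ij by (simp add: H_def scalar_prod_def atLeast0LessThan)
      \<comment> \<open>In the expanded product, the term with both indicators and one mixed term
        live at \<open>k = i\<close>, the other mixed term at \<open>k = j\<close>; the squares
        \<open>(w k)^2\<close> add up to \<open>c\<close>.\<close>
      also have "\<dots> = (\<Sum>k<n. (if k = i then (if i = j then 1 else 0) - 2 / c * w i * w j else 0)
          - (if k = j then 2 / c * w i * w j else 0) + 4 / c\<^sup>2 * w i * w j * (w k)\<^sup>2)"
        by (intro sum.cong) (auto simp: algebra_simps power2_eq_square)
      also have "\<dots> = (if i = j then 1 else 0) - 4 / c * w i * w j + 4 / c\<^sup>2 * w i * w j * c"
        using ij by (simp add: sum.distrib sum_subtractf c_def sum_distrib_left sum_divide_distrib)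
      also have "\<dots> = 1\<^sub>m n $$ (i, j)"
        using ij c0 by (simp add: power2_eq_square)
      finally show "(H * H) $$ (i, j) = 1\<^sub>m n $$ (i, j)" .
    qed (auto simp: H_def)
    show "H *\<^sub>v unit_vec n 0 = v"
    proof (rule eq_vecI)
      fix i assume "i < dim_vec v"
      then have i: "i < n" using v by simp
      have "(H *\<^sub>v unit_vec n 0) $ i = H $$ (i, 0)"
        using i n by (simp add: H_def)
      also have "\<dots> = v $ i"
        using i n c0 by (simp add: H_def w_def field_simps c)
      finally show "(H *\<^sub>v unit_vec n 0) $ i = v $ i" .
    qed (use v in \<open>simp add: H_def\<close>)
  qed
qed

text \<open>Induction on the dimension. Conjugating with a reflection that moves a unit eigenvector
  to \<open>unit_vec ?n 0\<close> clears column 0 off the diagonal, and by symmetry row 0 as well.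
  What remains is a smaller symmetric block \<open>C\<close>, to which the induction hypothesis
  applies.\<close>

theorem symmetric_real_diagonalizable:
  fixes A :: "real mat"
  assumes "A \<in> carrier_mat n n" and "transpose_mat A = A"
  shows "\<exists>P d. P \<in> carrier_mat n n \<and> transpose_mat P * P = 1\<^sub>m n \<and>
    A = P * mat_diag n d * transpose_mat P"
  using assms
proof (induction n arbitrary: A)
  case 0
  then show ?case
    by (intro exI[of _ "1\<^sub>m 0"] exI[of _ "\<lambda>_. 0"]) auto
next
  case (Suc m)
  let ?n = "Suc m"
  note A = Suc.prems(1) and sym = Suc.prems(2)
  obtain e v0 where "eigenvector A v0 e"
    by (rule symmetric_real_eigenvector[OF A sym]) auto
  then have v0: "v0 \<in> carrier_vec ?n" "v0 \<noteq> 0\<^sub>v ?n" "A *\<^sub>v v0 = e \<cdot>\<^sub>v v0"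
    using A by (auto simp: eigenvector_def)
  define r where "r = sqrt (v0 \<bullet> v0)"
  have "0 < v0 \<bullet> v0"
    using scalar_prod_self_eq_0[OF v0(1)] scalar_prod_self_ge_0[of v0] v0(2) by linarith
  then have r: "0 < r" "r * r = v0 \<bullet> v0" by (auto simp: r_def)
  define v where "v = (1 / r) \<cdot>\<^sub>v v0"
  have v: "v \<in> carrier_vec ?n" and Av: "A *\<^sub>v v = e \<cdot>\<^sub>v v"
    using v0 A by (auto simp: v_def mult_mat_vec[OF A] smult_smult_assoc mult.commute)
  have "v \<bullet> v = (v0 \<bullet> v0) / (r * r)"
    using v0 by (simp add: v_def)
  then have vv: "v \<bullet> v = 1" using r \<open>0 < v0 \<bullet> v0\<close> by simp
  obtain H where H: "H \<in> carrier_mat ?n ?n" "transpose_mat H = H" "H * H = 1\<^sub>m ?n"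
    "H *\<^sub>v unit_vec ?n 0 = v"
    using reflection_to_unit_vec[OF v vv] by auto
  define B where "B = H * A * H"
  have B: "B \<in> carrier_mat ?n ?n" using H A by (simp add: B_def)
  have symB: "transpose_mat B = B"
    using H A sym by (simp add: B_def transpose_mult[of _ ?n ?n _ ?n])
  have Hv: "H *\<^sub>v v = unit_vec ?n 0"
    using H(3) H(1) by (simp flip: H(4) assoc_mult_mat_vec[of _ ?n ?n _ ?n])
  have "B *\<^sub>v unit_vec ?n 0 = H *\<^sub>v (A *\<^sub>v (H *\<^sub>v unit_vec ?n 0))"
    using H(1) A by (simp add: B_def assoc_mult_mat_vec[of _ ?n ?n _ ?n])
  also have "\<dots> = e \<cdot>\<^sub>v unit_vec ?n 0"
    using v H(1) by (simp add: H(4) Av mult_mat_vec[OF H(1)] Hv)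
  finally have Be: "B *\<^sub>v unit_vec ?n 0 = e \<cdot>\<^sub>v unit_vec ?n 0" .
  have col: "B $$ (i, 0) = (if i = 0 then e else 0)" if "i < ?n" for i
    using arg_cong[OF Be, of "\<lambda>u. u $ i"] that B by simp
  have row: "B $$ (0, i) = (if i = 0 then e else 0)" if "i < ?n" for i
    using col[OF that] arg_cong[OF symB, of "\<lambda>X. X $$ (i, 0)"] that B by simp
  define C where "C = mat m m (\<lambda>(i, j). B $$ (Suc i, Suc j))"
  have C: "C \<in> carrier_mat m m" by (simp add: C_def)
  have "B $$ (j, i) = B $$ (i, j)" if "i < ?n" "j < ?n" for i j
    using arg_cong[OF symB, of "\<lambda>X. X $$ (i, j)"] that B by simp
  then have "transpose_mat C = C"
    by (intro eq_matI) (auto simp: C_def)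
  then obtain Q d where Q: "Q \<in> carrier_mat m m" "transpose_mat Q * Q = 1\<^sub>m m"
    and CQ: "C = Q * mat_diag m d * transpose_mat Q"
    using Suc.IH[OF C] by blast
  have Bblock: "B = four_block_mat (e \<cdot>\<^sub>m 1\<^sub>m 1) (0\<^sub>m 1 m) (0\<^sub>m m 1) C"
    using B by (intro eq_matI) (auto simp: C_def col row not_less_eq less_Suc_eq_0_disj)
  define R where "R = four_block_mat (1\<^sub>m 1) (0\<^sub>m 1 m) (0\<^sub>m m 1) Q"
  have R: "R \<in> carrier_mat ?n ?n"
    using four_block_carrier_mat[OF one_carrier_mat[of 1] Q(1)] by (simp add: R_def)
  have RT: "transpose_mat R = four_block_mat (1\<^sub>m 1) (0\<^sub>m 1 m) (0\<^sub>m m 1) (transpose_mat Q)"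
    using Q(1) by (simp add: R_def transpose_four_block_mat[of _ 1 1 _ m _ m])
  have D: "mat_diag ?n (case_nat e d) =
      four_block_mat (e \<cdot>\<^sub>m 1\<^sub>m 1) (0\<^sub>m 1 m) (0\<^sub>m m 1) (mat_diag m d)"
    by (intro eq_matI) (auto simp: mat_diag_def less_Suc_eq_0_disj)
  have RR: "transpose_mat R * R = 1\<^sub>m ?n"
    unfolding RT unfolding R_def using Q
    by (subst mult_four_block_mat[of _ 1 1 _ m _ m _ _ 1 _ m]) auto
  have QD: "Q * mat_diag m d \<in> carrier_mat m m"
    and QDQ: "Q * mat_diag m d * transpose_mat Q \<in> carrier_mat m m"
    using mult_carrier_mat[OF Q(1) mat_diag_dim] Q(1) by auto
  have BR: "B = R * mat_diag ?n (case_nat e d) * transpose_mat R"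
    unfolding RT unfolding R_def D Bblock CQ using Q
    by (subst mult_four_block_mat[of _ 1 1 _ m _ m _ _ 1 _ m],
        auto simp: left_mult_zero_mat[OF mat_diag_dim] right_mult_zero_mat[OF QD]
          left_add_zero_mat[OF QDQ])+
  let ?D = "mat_diag ?n (case_nat e d)"
  have D: "?D \<in> carrier_mat ?n ?n" by simp
  show ?case
  proof (intro exI conjI)
    show "H * R \<in> carrier_mat ?n ?n" using H(1) R by simp
    have T: "transpose_mat (H * R) = transpose_mat R * H"
      using H R by (simp add: transpose_mult[of _ ?n ?n _ ?n])
    have "transpose_mat R * H * (H * R) = transpose_mat R * (H * H) * R"
      using H(1) R by (simp add: assoc_mult_mat[of _ ?n ?n _ ?n _ ?n])
    then show "transpose_mat (H * R) * (H * R) = 1\<^sub>m ?n"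
      using H(3) R RR by (simp add: T)
    \<comment> \<open>As \<open>H\<close> is an involution, \<open>A\<close> is recovered as
      \<open>H * B * H\<close>; the orthogonal factor for \<open>A\<close> is therefore
      \<open>H * R\<close>.\<close>
    have "A = (H * H) * A * (H * H)"
      using A by (simp add: H(3))
    also have "\<dots> = H * B * H"
      using H(1) A by (simp add: B_def assoc_mult_mat[of _ ?n ?n _ ?n _ ?n])
    also have "\<dots> = H * R * ?D * (transpose_mat R * H)"
      using H(1) R D by (simp add: BR assoc_mult_mat[of _ ?n ?n _ ?n _ ?n] del: mat_diag_dim)
    finally show "A = H * R * ?D * transpose_mat (H * R)"
      by (simp add: T)
  qed
qed

section \<open>Diagonal form and the number of negative eigenvalues\<close>

text \<open>This turns the algebraic multiplicity in \<open>one_negative_eigenvalue\<close> into a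
  count of diagonal entries.\<close>

lemma order_prod_list_linear:
  fixes a :: real
  shows "Polynomial.order a (\<Prod>x\<leftarrow>xs. [:- x, 1:]) = count_list xs a"
proof (induction xs)
  case (Cons x xs)
  have "(\<Prod>x\<leftarrow>xs. [:- x, 1:]) \<noteq> (0 :: real poly)"
    by (auto simp: prod_list_zero_iff)
  then have "Polynomial.order a (\<Prod>x\<leftarrow>x # xs. [:- x, 1:]) =
      Polynomial.order a [:- x, 1:] + count_list xs a"
    using Cons by (simp add: order_mult del: mult_pCons_left)
  also have "Polynomial.order a [:- x, 1:] = (if x = a then 1 else 0)"
    proof (cases "x = a")
    case True
    then show ?thesis using order_power_n_n[of a 1] by simp
  next
    case False
    then show ?thesis by (simp add: order_0I)
  qed
  finally show ?case by simp
qed simp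

lemma quadratic_form_sum:
  fixes A :: "'a :: comm_semiring_1 mat"
  assumes "A \<in> carrier_mat n n" "x \<in> carrier_vec n" "y \<in> carrier_vec n"
  shows "x \<bullet> (A *\<^sub>v y) = (\<Sum>i<n. \<Sum>j<n. x $ i * A $$ (i, j) * y $ j)"
  using assms by (simp add: scalar_prod_def atLeast0LessThan sum_distrib_left mult.assoc)

text \<open>\<open>Q\<close> is the passage to coordinates in an orthonormal eigenbasis. Its
  surjectivity allows vectors with prescribed eigencoordinates, and the last clause replaces roots
  of the characteristic polynomial by signs of the coefficients \<open>d\<close>.\<close>

lemma inertia_decomposition:
  fixes A :: "real mat"
  assumes A: "A \<in> carrier_mat n n" and sym: "transpose_mat A = A"
  obtains d Q where "Q \<in> carrier_mat n n"
    and "\<And>x. x \<in> carrier_vec n \<Longrightarrow> x \<bullet> (A *\<^sub>v x) = (\<Sum>i<n. d i * ((Q *\<^sub>v x) $ i)\<^sup>2)"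
    and "\<And>y. y \<in> carrier_vec n \<Longrightarrow> \<exists>x \<in> carrier_vec n. Q *\<^sub>v x = y"
    and "one_negative_eigenvalue A \<longleftrightarrow> (\<exists>k<n. d k < 0 \<and> (\<forall>i<n. i \<noteq> k \<longrightarrow> 0 \<le> d i))"
proof -
  obtain P d where P: "P \<in> carrier_mat n n" and PP: "transpose_mat P * P = 1\<^sub>m n"
    and AP: "A = P * mat_diag n d * transpose_mat P"
    using symmetric_real_diagonalizable[OF A sym] by blast
  let ?Q = "transpose_mat P" and ?D = "mat_diag n d"
  have Q: "?Q \<in> carrier_mat n n" using P by simp
  have PQ: "P * ?Q = 1\<^sub>m n"
    by (rule mat_mult_left_right_inverse[OF Q P PP])
  have form: "x \<bullet> (A *\<^sub>v x) = (\<Sum>i<n. d i * ((?Q *\<^sub>v x) $ i)\<^sup>2)" if x: "x \<in> carrier_vec n" for x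
  proof -
    have "x \<bullet> (A *\<^sub>v x) = x \<bullet> (P *\<^sub>v (?D *\<^sub>v (?Q *\<^sub>v x)))"
      using P Q x by (simp add: AP assoc_mult_mat_vec[of _ n n _ n])
    also have "\<dots> = (?Q *\<^sub>v x) \<bullet> (?D *\<^sub>v (?Q *\<^sub>v x))"
      using transpose_vec_mult_scalar[of P n n "?D *\<^sub>v (?Q *\<^sub>v x)" x] P Q x
        mult_mat_vec_carrier[OF mat_diag_dim[of n d], of "?Q *\<^sub>v x"]
      by simp
    also have "\<dots> = (\<Sum>i<n. d i * ((?Q *\<^sub>v x) $ i)\<^sup>2)"
      using Q x by (subst quadratic_form_sum[of _ n])
        (auto simp: mat_diag_def power2_eq_square if_distrib if_distribR algebra_simps cong: if_cong)
    finally show ?thesis .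
  qed
  have "similar_mat A ?D"
    using P Q PP PQ A AP by (intro similar_matI[of A ?D P ?Q n]) auto
  then have "char_poly A = char_poly ?D" by (rule char_poly_similar)
  also have "\<dots> = (\<Prod>a\<leftarrow>diag_mat ?D. [:- a, 1:])"
    by (rule char_poly_upper_triangular[of _ n]) (auto simp: mat_diag_def)
  also have "diag_mat ?D = map d [0..<n]"
    by (auto simp: diag_mat_def mat_diag_def)
  finally have char: "char_poly A = (\<Prod>a\<leftarrow>map d [0..<n]. [:- a, 1:])" .
  have ev: "eigenvalue A k \<longleftrightarrow> (\<exists>i<n. d i = k)" for k
    unfolding eigenvalue_root_char_poly[OF A] char
    by (auto simp: poly_prod_list prod_list_zero_iff)
  have ord: "Polynomial.order e (char_poly A) = card {i. i < n \<and> d i = e}" for e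
    unfolding char order_prod_list_linear
    by (auto simp: count_list_eq_length_filter length_filter_conv_card intro!: arg_cong[of _ _ card])
  have "one_negative_eigenvalue A \<longleftrightarrow> (\<exists>k<n. d k < 0 \<and> (\<forall>i<n. i \<noteq> k \<longrightarrow> 0 \<le> d i))"
  proof
    assume "one_negative_eigenvalue A"
    then obtain e where e: "{k. eigenvalue A k \<and> k < 0} = {e}" "card {i. i < n \<and> d i = e} = 1"
      by (auto simp: one_negative_eigenvalue_def ord)
    then obtain k where k: "{i. i < n \<and> d i = e} = {k}"
      by (auto simp: card_1_singleton_iff)
    then have kn: "k < n" "d k = e" by auto
    have e1: "eigenvalue A l \<and> l < 0 \<longleftrightarrow> l = e" for l
      using e(1) unfolding set_eq_iff by blast
    then have "e < 0" by blast
    moreover have "0 \<le> d i" if "i < n" "i \<noteq> k" for i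
    proof (rule ccontr)
      assume "\<not> 0 \<le> d i"
      then have "d i = e" using e1[of "d i"] that(1) ev[of "d i"] by auto
      then have "i \<in> {k}" unfolding k[symmetric] using that(1) by simp
      with that(2) show False by simp
    qed
    ultimately show "\<exists>k<n. d k < 0 \<and> (\<forall>i<n. i \<noteq> k \<longrightarrow> 0 \<le> d i)"
      using kn by blast
  next
    assume "\<exists>k<n. d k < 0 \<and> (\<forall>i<n. i \<noteq> k \<longrightarrow> 0 \<le> d i)"
    then obtain k where k: "k < n" "d k < 0" and pos: "\<And>i. i < n \<Longrightarrow> i \<noteq> k \<Longrightarrow> 0 \<le> d i"
      by auto
    have "{l. eigenvalue A l \<and> l < 0} = {d k}"
      using k by (auto simp: ev) (metis pos not_le)
    moreover have "{i. i < n \<and> d i = d k} = {k}"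
      using k by (auto) (metis pos not_le)
    ultimately show "one_negative_eigenvalue A"
      by (auto simp: one_negative_eigenvalue_def ord intro!: exI[of _ "d k"])
  qed
  moreover have "\<exists>x \<in> carrier_vec n. ?Q *\<^sub>v x = y" if "y \<in> carrier_vec n" for y
    using that P Q PP by (intro bexI[of _ "P *\<^sub>v y"]) (auto simp flip: assoc_mult_mat_vec)
  ultimately show thesis
    using that[OF Q form] by blast
qed

text \<open>The form is nonnegative where the coordinate \<open>k\<close> of the single negative
  eigenvalue vanishes. Some nonzero combination of \<open>x\<close> and \<open>y\<close> has this
  property, yet by orthogonality the form is negative on it.\<close>

lemma one_negative_eigenvalue_no_negative_plane:
  fixes A :: "real mat"
  assumes A: "A \<in> carrier_mat n n" and sym: "transpose_mat A = A"
    and neg: "one_negative_eigenvalue A"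
    and x: "x \<in> carrier_vec n" "x \<bullet> (A *\<^sub>v x) < 0"
    and y: "y \<in> carrier_vec n" "y \<bullet> (A *\<^sub>v y) < 0"
    and orth: "x \<bullet> (A *\<^sub>v y) = 0"
  shows False
proof -
  obtain d Q where Q: "Q \<in> carrier_mat n n"
    and form: "\<And>x. x \<in> carrier_vec n \<Longrightarrow> x \<bullet> (A *\<^sub>v x) = (\<Sum>i<n. d i * ((Q *\<^sub>v x) $ i)\<^sup>2)"
    and "one_negative_eigenvalue A \<longleftrightarrow> (\<exists>k<n. d k < 0 \<and> (\<forall>i<n. i \<noteq> k \<longrightarrow> 0 \<le> d i))"
    by (rule inertia_decomposition[OF A sym]) blast
  with neg obtain k where k: "k < n" and pos: "\<And>i. i < n \<Longrightarrow> i \<noteq> k \<Longrightarrow> 0 \<le> d i"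
    by auto
  have nonneg: "0 \<le> z \<bullet> (A *\<^sub>v z)" if "z \<in> carrier_vec n" "(Q *\<^sub>v z) $ k = 0" for z
    unfolding form[OF that(1)] using pos that(2) by (intro sum_nonneg) (metis lessThan_iff mult_nonneg_nonneg
      mult_zero_right power_zero_numeral zero_le_power2 order_refl)
  define a where "a = (Q *\<^sub>v x) $ k"
  define b where "b = (Q *\<^sub>v y) $ k"
  have "a \<noteq> 0"
    using nonneg[OF x(1)] x(2) by (auto simp: a_def)
  \<comment> \<open>The coefficients are swapped so that the \<open>k\<close>-th eigencoordinate is
    \<open>b * a - a * b = 0\<close>; since \<open>a\<close> is nonzero, \<open>y\<close> really
    contributes.\<close>
  define z where "z = b \<cdot>\<^sub>v x - a \<cdot>\<^sub>v y"
  have z: "z \<in> carrier_vec n" using x y by (simp add: z_def)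
  have "(Q *\<^sub>v z) $ k = 0"
    using Q x y k by (simp add: z_def a_def b_def mult_minus_distrib_mat_vec[of _ n n] mult_mat_vec[of _ n n])
  then have "0 \<le> z \<bullet> (A *\<^sub>v z)"
    by (rule nonneg[OF z])
  moreover have "y \<bullet> (A *\<^sub>v x) = 0"
    using orth transpose_vec_mult_scalar[OF A y(1) x(1)] comm_scalar_prod[OF y(1), of "A *\<^sub>v x"]
      comm_scalar_prod[OF x(1), of "A *\<^sub>v y"] A x y sym by simp
  then have "z \<bullet> (A *\<^sub>v z) = b\<^sup>2 * (x \<bullet> (A *\<^sub>v x)) + a\<^sup>2 * (y \<bullet> (A *\<^sub>v y))"
    using A x y orth
    by (simp add: z_def mult_minus_distrib_mat_vec[of _ n n] mult_mat_vec[of _ n n]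
        scalar_prod_minus_distrib[of _ n] minus_scalar_prod_distrib[of _ n] power2_eq_square)
  moreover have "b\<^sup>2 * (x \<bullet> (A *\<^sub>v x)) \<le> 0"
    using x(2) by (simp add: mult_nonneg_nonpos)
  moreover have "a\<^sup>2 * (y \<bullet> (A *\<^sub>v y)) < 0"
    using y(2) \<open>a \<noteq> 0\<close> by (simp add: mult_pos_neg)
  ultimately show False by linarith
qed

text \<open>The vector \<open>x\<close> forces at least one negative coefficient. Two of them would
  span a negative definite plane, which meets the hyperplane orthogonal to \<open>l\<close> in a
  nonzero vector.\<close>

lemma one_negative_eigenvalueI:
  fixes A :: "real mat"
  assumes A: "A \<in> carrier_mat n n" and sym: "transpose_mat A = A"
    and x: "x \<in> carrier_vec n" "x \<bullet> (A *\<^sub>v x) < 0"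
    and l: "l \<in> carrier_vec n" "\<And>z. z \<in> carrier_vec n \<Longrightarrow> l \<bullet> z = 0 \<Longrightarrow> 0 \<le> z \<bullet> (A *\<^sub>v z)"
  shows "one_negative_eigenvalue A"
proof -
  obtain d Q where Q: "Q \<in> carrier_mat n n"
    and form: "\<And>x. x \<in> carrier_vec n \<Longrightarrow> x \<bullet> (A *\<^sub>v x) = (\<Sum>i<n. d i * ((Q *\<^sub>v x) $ i)\<^sup>2)"
    and surj: "\<And>y. y \<in> carrier_vec n \<Longrightarrow> \<exists>x \<in> carrier_vec n. Q *\<^sub>v x = y"
    and iff: "one_negative_eigenvalue A \<longleftrightarrow> (\<exists>k<n. d k < 0 \<and> (\<forall>i<n. i \<noteq> k \<longrightarrow> 0 \<le> d i))"
    by (rule inertia_decomposition[OF A sym]) blast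
  obtain k where k: "k < n" "d k < 0"
  proof (rule ccontr)
    assume "\<not> thesis"
    with that have "0 \<le> d i" if "i < n" for i
      using \<open>i < n\<close> not_le by blast
    then have "0 \<le> x \<bullet> (A *\<^sub>v x)"
      unfolding form[OF x(1)] by (intro sum_nonneg) auto
    with x(2) show False by simp
  qed
  have "0 \<le> d i" if i: "i < n" "i \<noteq> k" for i
  proof (rule ccontr)
    assume "\<not> 0 \<le> d i"
    obtain u where u: "u \<in> carrier_vec n" "Q *\<^sub>v u = unit_vec n i"
      using surj[of "unit_vec n i"] by auto
    obtain w where w: "w \<in> carrier_vec n" "Q *\<^sub>v w = unit_vec n k"
      using surj[of "unit_vec n k"] by auto
    \<comment> \<open>The pair \<open>(a, b)\<close> solves
      \<open>a * (l . u) + b * (l . w) = 0\<close>; the default 1 keeps it nonzero when both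
      products vanish.\<close>
    define a where "a = (if l \<bullet> u = 0 \<and> l \<bullet> w = 0 then 1 else l \<bullet> w)"
    define b where "b = - (l \<bullet> u)"
    define z where "z = a \<cdot>\<^sub>v u + b \<cdot>\<^sub>v w"
    have z: "z \<in> carrier_vec n" using u w by (simp add: z_def)
    have "l \<bullet> z = 0"
      using l(1) u w by (simp add: z_def scalar_prod_add_distrib[of _ n] a_def b_def)
    then have "0 \<le> z \<bullet> (A *\<^sub>v z)" using l(2) z by blast
    also have Qz: "Q *\<^sub>v z = a \<cdot>\<^sub>v unit_vec n i + b \<cdot>\<^sub>v unit_vec n k"
      using Q u w by (simp add: z_def mult_add_distrib_mat_vec[of _ n n] mult_mat_vec[of _ n n])
    have "z \<bullet> (A *\<^sub>v z) = (\<Sum>j<n. (if j = i then d i * a\<^sup>2 else 0) + (if j = k then d k * b\<^sup>2 else 0))"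
      unfolding form[OF z] Qz using i k by (intro sum.cong) auto
    also have "\<dots> = d i * a\<^sup>2 + d k * b\<^sup>2"
      using i k by (simp add: sum.distrib)
    finally have "0 \<le> d i * a\<^sup>2 + d k * b\<^sup>2" .
    moreover have "a \<noteq> 0 \<or> b \<noteq> 0" by (auto simp: a_def b_def)
    then have "d i * a\<^sup>2 + d k * b\<^sup>2 < 0"
      using \<open>\<not> 0 \<le> d i\<close> k(2)
      by (smt (verit) mult_neg_pos mult_nonpos_nonneg zero_le_power2 zero_less_power2)
    ultimately show False by simp
  qed
  with k show ?thesis unfolding iff by blast
qed

section \<open>Kernel dimension: prescribed zeros and bounds\<close>

text \<open>Vanishing on \<open>S\<close> imposes \<open>card S\<close> linear conditions on the
  coefficients with respect to a kernel basis, fewer than there are coefficients.\<close>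

lemma kernel_vector_vanishing_on:
  fixes M :: "'a :: field mat"
  assumes M: "M \<in> carrier_mat nr nc" and S: "finite S" "S \<subseteq> {..<nc}" "card S < kernel_dim M"
  obtains x where "x \<in> carrier_vec nc" "x \<noteq> 0\<^sub>v nc" "M *\<^sub>v x = 0\<^sub>v nr" "\<And>s. s \<in> S \<Longrightarrow> x $ s = 0"
proof -
  interpret K: kernel nr nc M by unfold_locales (rule M)
  obtain B where B: "finite B" "K.basis B"
    using kernel_basis_exists[OF M] by blast
  define k where "k = card B"
  have cardS: "card S < k"
    using S(3) K.Ker.dim_basis[OF B] by (simp add: k_def)
  have Bker: "B \<subseteq> mat_kernel M" and indep: "\<not> K.lin_dep B"
    using B(2) by (auto simp: K.Ker.basis_def)
  obtain b where b: "bij_betw b {..<k} B"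
    using ex_bij_betw_nat_finite[OF B(1)] by (auto simp: k_def atLeast0LessThan)
  obtain s where s: "bij_betw s {..<card S} S"
    using ex_bij_betw_nat_finite[OF S(1)] by (auto simp: atLeast0LessThan)
  \<comment> \<open>The conditions are padded with zero rows to a square system, so that a vanishing
    determinant yields a solution; the last row is zero because \<open>card S < k\<close>.\<close>
  define C where "C = mat k k (\<lambda>(i, j). if i < card S then b j $ s i else 0)"
  have C: "C \<in> carrier_mat k k" by (simp add: C_def)
  have "transpose_mat C *\<^sub>v unit_vec k (k - 1) = 0\<^sub>v k"
    using cardS by (intro eq_vecI) (auto simp: C_def)
  then have "det (transpose_mat C) = 0"
    using C cardS by (subst det_0_iff_vec_prod_zero[of _ k]) (auto intro!: exI[of _ "unit_vec k (k - 1)"])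
  then have "det C = 0" by (simp add: det_transpose[OF C])
  then obtain c where c: "c \<in> carrier_vec k" "c \<noteq> 0\<^sub>v k" "C *\<^sub>v c = 0\<^sub>v k"
    using det_0_iff_vec_prod_zero[OF C] by blast
  define a where "a v = c $ inv_into {..<k} b v" for v
  have ab: "a (b j) = c $ j" if "j < k" for j
    using that bij_betw_inv_into_left[OF b] by (simp add: a_def)
  define x where "x = K.lincomb a B"
  have xker: "x \<in> mat_kernel M"
    unfolding x_def by (rule K.Ker.lincomb_closed[OF Bker]) auto
  have "x \<noteq> 0\<^sub>v nc"
  proof
    assume "x = 0\<^sub>v nc"
    obtain j where j: "j < k" "c $ j \<noteq> 0"
      using c(1,2) by (auto simp: vec_eq_iff)
    have "K.lin_dep B"
      unfolding K.Ker.lin_dep_def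
      using \<open>x = 0\<^sub>v nc\<close> B(1) j ab[OF j(1)] bij_betwE[OF b]
      by (intro exI[of _ B] exI[of _ a] exI[of _ "b j"]) (auto simp: x_def)
    with indep show False by simp
  qed
  moreover have "x $ t = 0" if t: "t \<in> S" for t
  proof -
    have "t \<in> s ` {..<card S}"
      using t bij_betw_imp_surj_on[OF s] by simp
    then obtain i where i: "i < card S" "s i = t" by auto
    have "x $ t = (\<Sum>v\<in>B. a v * v $ t)"
      unfolding x_def using t S(2) by (intro K.lincomb_index[OF _ Bker]) auto
    also have "\<dots> = (\<Sum>j<k. c $ j * b j $ t)"
      using b by (subst sum.reindex_bij_betw[OF b, symmetric]) (simp add: ab)
    also have "\<dots> = (C *\<^sub>v c) $ i"
      using i cardS c(1) by (auto simp: C_def scalar_prod_def atLeast0LessThan mult.commute intro!: sum.cong)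
    also have "\<dots> = 0" using c(3) i cardS by simp
    finally show ?thesis .
  qed
  ultimately show thesis
    using that mat_kernelD[OF M xker] by blast
qed

text \<open>In row echelon form the pivots are counted by the nonzero rows, of which there are at
  most \<open>nr\<close>.\<close>

lemma kernel_dim_ge:
  fixes M :: "'a :: field mat"
  assumes M: "M \<in> carrier_mat nr nc"
  shows "nc - nr \<le> kernel_dim M"
proof -
  have "row_echelon_form (gauss_jordan_single M)" "gauss_jordan_single M \<in> carrier_mat nr nc"
    using gauss_jordan_single[OF M refl] by auto
  from find_base_vectors(5)[OF this]
  have "length (pivot_positions (gauss_jordan_single M)) \<le> nr"
    using card_mono[of "{..<nr}" "{i. i < nr \<and> row (gauss_jordan_single M) i \<noteq> 0\<^sub>v nc}"] by auto
  then show ?thesis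
    using M by (simp add: kernel_dim_code)
qed

text \<open>A basis of the kernel of \<open>B\<close> lies in the kernel of \<open>A * B\<close>.
  Independence in either kernel means independence in the ambient space, so it carries over.\<close>

lemma kernel_dim_mult_le:
  fixes A :: "'a :: field mat"
  assumes A: "A \<in> carrier_mat n nr" and B: "B \<in> carrier_mat nr nc"
  shows "kernel_dim B \<le> kernel_dim (A * B)"
proof -
  have AB: "A * B \<in> carrier_mat n nc" using A B by simp
  interpret K: kernel nr nc B by unfold_locales (rule B)
  interpret L: kernel n nc "A * B" by unfold_locales (rule AB)
  obtain S where S: "finite S" "K.basis S"
    using kernel_basis_exists[OF B] by blast
  then have sub: "S \<subseteq> mat_kernel B" and "\<not> K.lin_dep S"
    by (auto simp: K.Ker.basis_def)
  have sub': "S \<subseteq> mat_kernel (A * B)"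
    using sub mat_kernel_mult_subset[OF B A] by blast
  have "\<not> L.lin_dep S"
    using \<open>\<not> K.lin_dep S\<close> K.lindep_same[OF sub] L.lindep_same[OF sub'] by simp
  moreover have "L.Ker.fin_dim"
    using kernel_basis_exists[OF AB] unfolding L.Ker.fin_dim_def L.Ker.basis_def by blast
  ultimately have "card S \<le> L.dim"
    using L.Ker.li_le_dim(2)[OF _ sub'] by simp
  then show ?thesis
    using K.Ker.dim_basis[OF S] by simp
qed

section \<open>Sign rule for kernel vectors\<close>

lemma cdv_matricesD:
  assumes "M \<in> cdv_matrices G" "card (pverts G) = n"
  shows "M \<in> carrier_mat n n" "transpose_mat M = M" "cdv_pattern G n M" "one_negative_eigenvalue M"
    "strong_arnold n M"
  using assms by (auto simp: cdv_matrices_def Let_def)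

lemma kernel_vector_row:
  assumes "M \<in> carrier_mat n n" "x \<in> carrier_vec n" "M *\<^sub>v x = 0\<^sub>v n" "v < n"
  shows "(\<Sum>j<n. M $$ (v, j) * x $ j) = 0"
  using arg_cong[OF assms(3), of "\<lambda>y. y $ v"] assms(1,2,4)
  by (simp add: scalar_prod_def atLeast0LessThan)

definition nbrs :: "nat pair_pre_digraph \<Rightarrow> nat \<Rightarrow> nat set" where
  "nbrs G v = {u. (v + 1, u + 1) \<in> parcs G}"

lemma cdv_pattern_iff_nbrs:
  "cdv_pattern G n M \<longleftrightarrow>
     (\<forall>i<n. \<forall>j<n. i \<noteq> j \<longrightarrow> (if j \<in> nbrs G i then M $$ (i, j) < 0 else M $$ (i, j) = 0))"
  by (simp add: cdv_pattern_def nbrs_def)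

text \<open>
  Row \<open>v\<close> of \<open>M x = 0\<close>: a negative entry of \<open>x\<close> at a neighbour contributes a positive
  summand, which only a positive entry at another neighbour can compensate.
\<close>

lemma kernel_vector_positive_neighbour:
  assumes M: "M \<in> carrier_mat n n" and pat: "cdv_pattern G n M"
    and x: "x \<in> carrier_vec n" "M *\<^sub>v x = 0\<^sub>v n"
    and v: "v < n" "nbrs G v \<subseteq> {..<n} - {v}" "0 \<le> M $$ (v, v) * x $ v"
    and u: "u \<in> nbrs G v" "x $ u < 0"
  shows "\<exists>w \<in> nbrs G v. 0 < x $ w"
proof (rule ccontr)
  assume none: "\<not> ?thesis"
  have neg: "M $$ (v, j) < 0" if "j \<in> nbrs G v" for j
  proof -
    have "j < n" "v \<noteq> j" using that v(2) by auto
    then show ?thesis using pat that v(1) by (simp add: cdv_pattern_iff_nbrs)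
  qed
  have entry: "0 \<le> M $$ (v, j) * x $ j" if "j < n" for j
  proof -
    consider "j = v" | "j \<in> nbrs G v" | "j \<noteq> v" "j \<notin> nbrs G v" by blast
    then show ?thesis
    proof cases
      case 2
      then have "M $$ (v, j) < 0" "x $ j \<le> 0" using neg none by (auto simp: not_less)
      then show ?thesis by (simp add: mult_nonpos_nonpos)
    next
      case 3
      then have "M $$ (v, j) = 0" using pat that v(1) by (simp add: cdv_pattern_iff_nbrs)
      then show ?thesis by simp
    qed (use v in simp)
  qed
  have "0 < M $$ (v, u) * x $ u"
    using neg u by (simp add: mult_neg_neg)
  then have "0 < (\<Sum>j<n. M $$ (v, j) * x $ j)"
    using entry u(1) v(2) by (intro sum_pos2[of _ u]) auto
  with kernel_vector_row[OF M x v(1)] show False by simp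
qed

lemma kernel_vector_negative_neighbour:
  assumes M: "M \<in> carrier_mat n n" and pat: "cdv_pattern G n M"
    and x: "x \<in> carrier_vec n" "M *\<^sub>v x = 0\<^sub>v n"
    and v: "v < n" "nbrs G v \<subseteq> {..<n} - {v}" "M $$ (v, v) * x $ v \<le> 0"
    and u: "u \<in> nbrs G v" "0 < x $ u"
  shows "\<exists>w \<in> nbrs G v. x $ w < 0"
proof -
  have "M *\<^sub>v (- x) = - (M *\<^sub>v x)"
    using M x(1) by (intro eq_vecI) auto
  also have "\<dots> = 0\<^sub>v n"
    unfolding x(2) by auto
  finally have "M *\<^sub>v (- x) = 0\<^sub>v n" .
  then have "\<exists>w \<in> nbrs G v. 0 < (- x) $ w"
    using assms by (intro kernel_vector_positive_neighbour[OF M pat, of "- x" v u]) auto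
  then show ?thesis using x(1) v(2) by auto
qed

text \<open>With \<open>x $ v = 0\<close> the diagonal entry drops out of row \<open>v\<close>, so
  both one-sided rules apply whatever its sign. The one-sided rules are also used directly for
  \<open>G_10_26\<close>, at vertices where \<open>x\<close> may be nonzero but the diagonal entry
  is known to be nonnegative.\<close>

lemma kernel_vector_signs:
  assumes "M \<in> carrier_mat n n" "cdv_pattern G n M" "x \<in> carrier_vec n" "M *\<^sub>v x = 0\<^sub>v n"
    and "v < n" "nbrs G v \<subseteq> {..<n} - {v}" "x $ v = 0"
  shows "(\<exists>u \<in> nbrs G v. x $ u < 0) \<longleftrightarrow> (\<exists>u \<in> nbrs G v. 0 < x $ u)"
  using kernel_vector_positive_neighbour[OF assms(1-6)] kernel_vector_negative_neighbour[OF assms(1-6)]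
    assms(7) by auto

section \<open>Neighbourhoods of the three graphs\<close>

lemma nbrs_graph_of_edges_empty: "nbrs (graph_of_edges n {}) v = {}"
  by (simp add: nbrs_def graph_of_edges_def)

text \<open>For computing neighbourhoods edge by edge. The bounds prevent truncated subtraction, so
  \<open>b - 1\<close> is the matrix index of vertex \<open>b\<close>.\<close>

lemma nbrs_graph_of_edges_insert:
  assumes "1 \<le> a" "1 \<le> b"
  shows "nbrs (graph_of_edges n (insert (a, b) E)) v =
    (if v + 1 = a then {b - 1} else {}) \<union> (if v + 1 = b then {a - 1} else {}) \<union>
    nbrs (graph_of_edges n E) v"
  using assms by (auto simp: nbrs_def graph_of_edges_def)

lemmas nbrs_graph_of_edges = nbrs_graph_of_edges_empty nbrs_graph_of_edges_insert

lemma nbrs_G_11_35: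
  "nbrs G_11_35 0 = {1, 2, 3, 4, 7, 8}" "nbrs G_11_35 1 = {0, 2, 3, 7, 10}"
  "nbrs G_11_35 2 = {0, 1, 3, 4, 5, 6, 7, 9, 10}" "nbrs G_11_35 3 = {0, 1, 2, 4, 5, 7, 8, 9}"
  "nbrs G_11_35 4 = {0, 2, 3, 5, 6, 8, 9, 10}" "nbrs G_11_35 5 = {2, 3, 4, 6, 7, 8, 9, 10}"
  "nbrs G_11_35 6 = {2, 4, 5, 10}" "nbrs G_11_35 7 = {0, 1, 2, 3, 5, 8}"
  "nbrs G_11_35 8 = {0, 3, 4, 5, 7}" "nbrs G_11_35 9 = {2, 3, 4, 5, 10}"
  "nbrs G_11_35 10 = {1, 2, 4, 5, 6, 9}"
  by (simp_all add: G_11_35_def nbrs_graph_of_edges insert_commute)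

lemma nbrs_G_10_30:
  "nbrs G_10_30 0 = {4, 6, 7, 8, 9}" "nbrs G_10_30 1 = {2, 3, 4, 5, 6, 9}"
  "nbrs G_10_30 2 = {1, 3, 5, 7, 8, 9}" "nbrs G_10_30 3 = {1, 2, 5, 7, 8}"
  "nbrs G_10_30 4 = {0, 1, 5, 6, 7, 9}" "nbrs G_10_30 5 = {1, 2, 3, 4, 6, 7, 8}"
  "nbrs G_10_30 6 = {0, 1, 4, 5, 8, 9}" "nbrs G_10_30 7 = {0, 2, 3, 4, 5, 9}"
  "nbrs G_10_30 8 = {0, 2, 3, 5, 6, 9}" "nbrs G_10_30 9 = {0, 1, 2, 4, 6, 7, 8}"
  by (simp_all add: G_10_30_def nbrs_graph_of_edges insert_commute)

lemma nbrs_G_10_26: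
  "nbrs G_10_26 0 = {1, 2, 3, 4, 7, 8}" "nbrs G_10_26 1 = {0, 3, 6, 7, 9}"
  "nbrs G_10_26 2 = {0, 3, 6, 7, 9}" "nbrs G_10_26 3 = {0, 1, 2, 4, 5, 7, 8}"
  "nbrs G_10_26 4 = {0, 3, 6, 8, 9}" "nbrs G_10_26 5 = {3, 6, 7, 8, 9}"
  "nbrs G_10_26 6 = {1, 2, 4, 5}" "nbrs G_10_26 7 = {0, 1, 2, 3, 5, 8}"
  "nbrs G_10_26 8 = {0, 3, 4, 5, 7}" "nbrs G_10_26 9 = {1, 2, 4, 5}"
  by (simp_all add: G_10_26_def nbrs_graph_of_edges insert_commute)

lemma all_less_10:
  "(\<forall>i<10. P i) \<longleftrightarrow> P 0 \<and> P 1 \<and> P 2 \<and> P 3 \<and> P 4 \<and> P 5 \<and> P 6 \<and> P 7 \<and> P 8 \<and> P (9 :: nat)"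
  by (simp add: numeral_eq_Suc All_less_Suc conj_ac)

lemma all_less_11: "(\<forall>i<11. P i) \<longleftrightarrow> (\<forall>i<10. P i) \<and> P (10 :: nat)"
  by (simp add: numeral_eq_Suc All_less_Suc conj_ac)

lemma sum_less_10:
  "sum f {..<10} = f 0 + f 1 + f 2 + f 3 + f 4 + f 5 + f 6 + f 7 + f 8 + f (9 :: nat)"
  by (simp add: numeral_eq_Suc)

lemma sum_less_11: "sum f {..<11} = sum f {..<10} + f (10 :: nat)"
  by (simp add: numeral_eq_Suc)

lemma vec_eq_0_iff:
  "x \<in> carrier_vec n \<Longrightarrow> x = 0\<^sub>v n \<longleftrightarrow> (\<forall>i<n. x $ i = 0)"
  by (auto simp: vec_eq_iff)

section \<open>Upper bounds on the corank\<close>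

text \<open>Each pair has opposite signs or vanishes, and signs cannot alternate around a
  triangle.\<close>

lemma opposite_signs_triangle:
  fixes a b c :: real
  assumes "a < 0 \<or> b < 0 \<longleftrightarrow> 0 < a \<or> 0 < b"
    and "a < 0 \<or> c < 0 \<longleftrightarrow> 0 < a \<or> 0 < c"
    and "b < 0 \<or> c < 0 \<longleftrightarrow> 0 < b \<or> 0 < c"
  shows "a = 0 \<and> b = 0 \<and> c = 0"
proof -
  consider "a < 0" | "0 < a" | "a = 0" by linarith
  then show ?thesis
  proof cases
    case 1
    then have "0 < b" "0 < c" using assms(1,2) by auto
    with assms(3) show ?thesis by auto
  next
    case 2
    then have "b < 0" "c < 0" using assms(1,2) by auto
    with assms(3) show ?thesis by auto
  next
    case 3
    moreover have "b = 0" using assms(1) 3 by (cases b "0 :: real" rule: linorder_cases) auto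
    moreover have "c = 0" using assms(2) 3 by (cases c "0 :: real" rule: linorder_cases) auto
    ultimately show ?thesis by simp
  qed
qed

lemma corank_G_11_35:
  assumes "M \<in> cdv_matrices G_11_35"
  shows "kernel_dim M \<le> 5"
proof (rule ccontr)
  assume "\<not> kernel_dim M \<le> 5"
  then have "card {1, 2, 4, 5, 6 :: nat} < kernel_dim M" by simp
  note M = cdv_matricesD[OF assms G_11_35_props(2)]
  from kernel_vector_vanishing_on[OF M(1) _ _ \<open>card _ < _\<close>]
  obtain x where x: "x \<in> carrier_vec 11" "x \<noteq> 0\<^sub>v 11" "M *\<^sub>v x = 0\<^sub>v 11"
    and zero: "\<And>s. s \<in> {1, 2, 4, 5, 6 :: nat} \<Longrightarrow> x $ s = 0"
    by auto
  note signs = kernel_vector_signs[OF M(1,3) x(1,3)]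
  have z: "x $ 1 = 0" "x $ 2 = 0" "x $ 4 = 0" "x $ 5 = 0" "x $ 6 = 0"
    using zero by auto
  \<comment> \<open>A zero vertex with a single neighbour not yet known to be zero forces that
    neighbour to vanish. This cascade leaves the indices 0, 7, 8, and rows 1, 4, 5 each see exactly
    two of them.\<close>
  have "x $ 10 = 0" using signs[of 6] z by (auto simp: nbrs_G_11_35)
  moreover from this have "x $ 9 = 0" using signs[of 10] z by (auto simp: nbrs_G_11_35)
  moreover from calculation have "x $ 3 = 0" using signs[of 9] z by (auto simp: nbrs_G_11_35)
  ultimately have "x = 0\<^sub>v 11"
    using z opposite_signs_triangle[of "x $ 0" "x $ 7" "x $ 8"] signs[of 1] signs[of 4] signs[of 5]
    by (simp add: vec_eq_0_iff[OF x(1)] all_less_11 all_less_10 nbrs_G_11_35 del: One_nat_def)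
  with x(2) show False by simp
qed

lemma corank_G_10_30:
  assumes "M \<in> cdv_matrices G_10_30"
  shows "kernel_dim M \<le> 5"
proof (rule ccontr)
  assume "\<not> kernel_dim M \<le> 5"
  then have "card {1, 2, 3, 5, 7 :: nat} < kernel_dim M" by simp
  note M = cdv_matricesD[OF assms G_10_30_props(2)]
  from kernel_vector_vanishing_on[OF M(1) _ _ \<open>card _ < _\<close>]
  obtain x where x: "x \<in> carrier_vec 10" "x \<noteq> 0\<^sub>v 10" "M *\<^sub>v x = 0\<^sub>v 10"
    and zero: "\<And>s. s \<in> {1, 2, 3, 5, 7 :: nat} \<Longrightarrow> x $ s = 0"
    by auto
  note signs = kernel_vector_signs[OF M(1,3) x(1,3)]
  have z: "x $ 1 = 0" "x $ 2 = 0" "x $ 3 = 0" "x $ 5 = 0" "x $ 7 = 0"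
    using zero by auto
  \<comment> \<open>The same cascade leaves 0, 4, 6. Row 8, whose entry has just been shown to
    vanish, supplies the third pair.\<close>
  have "x $ 8 = 0" using signs[of 3] z by (auto simp: nbrs_G_10_30)
  moreover from this have "x $ 9 = 0" using signs[of 2] z by (auto simp: nbrs_G_10_30)
  ultimately have "x = 0\<^sub>v 10"
    using z opposite_signs_triangle[of "x $ 0" "x $ 4" "x $ 6"] signs[of 5] signs[of 7] signs[of 8]
    by (simp add: vec_eq_0_iff[OF x(1)] all_less_10 nbrs_G_10_30 del: One_nat_def)
  with x(2) show False by simp
qed

text \<open>The unit vector at \<open>w\<close> is isotropic but not orthogonal to that at
  \<open>u\<close>, so the form takes negative values on their span. This span is orthogonal to the
  unit vector at \<open>v\<close>, which would complete a negative plane if its diagonal entry were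
  negative.\<close>

lemma one_negative_eigenvalue_isotropic:
  fixes A :: "real mat"
  assumes A: "A \<in> carrier_mat n n" and sym: "transpose_mat A = A"
    and neg: "one_negative_eigenvalue A" and less: "u < n" "v < n" "w < n"
    and entries: "A $$ (w, w) = 0" "A $$ (w, u) \<noteq> 0" "A $$ (v, w) = 0" "A $$ (v, u) = 0"
  shows "0 \<le> A $$ (v, v)"
proof (rule ccontr)
  assume vv: "\<not> 0 \<le> A $$ (v, v)"
  \<comment> \<open>Chosen to solve \<open>2 * s * A $$ (w, u) + A $$ (u, u) = - 1\<close>.\<close>
  define s where "s = - (A $$ (u, u) + 1) / (2 * A $$ (w, u))"
  have uw: "A $$ (u, w) = A $$ (w, u)"
    using arg_cong[OF sym, of "\<lambda>X. X $$ (w, u)"] A less by simp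
  define y where "y = s \<cdot>\<^sub>v unit_vec n w + unit_vec n u"
  have y: "y \<in> carrier_vec n" by (simp add: y_def)
  have Ay: "(A *\<^sub>v y) $ i = s * A $$ (i, w) + A $$ (i, u)" if "i < n" for i
    using A less that
    by (simp add: y_def mult_add_distrib_mat_vec[OF A] mult_mat_vec[OF A])
  have "y \<bullet> (A *\<^sub>v y) = s * (A *\<^sub>v y) $ w + (A *\<^sub>v y) $ u"
    using A less y by (simp add: y_def add_scalar_prod_distrib[of _ n])
  also have "\<dots> = 2 * s * A $$ (w, u) + A $$ (u, u)"
    using less by (simp add: Ay entries uw)
  also have "\<dots> = - 1"
    using entries(2) by (simp add: s_def field_simps)
  finally have "y \<bullet> (A *\<^sub>v y) < 0" by simp
  moreover have "unit_vec n v \<bullet> (A *\<^sub>v y) = 0"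
    using less scalar_prod_left_unit[OF mult_mat_vec_carrier[OF A y]] by (simp add: Ay entries)
  moreover have "unit_vec n v \<bullet> (A *\<^sub>v unit_vec n v) < 0"
    using less A vv by simp
  ultimately show False
    using one_negative_eigenvalue_no_negative_plane[OF A sym neg unit_vec_carrier _ y] by blast
qed

text \<open>If \<open>d > 0\<close>, the first three conditions make at least two of
  \<open>a\<close>, \<open>b\<close>, \<open>c\<close> negative and the last makes the third
  positive. The rule for that third number then demands a positive one among the two negative ones.
  The case \<open>d < 0\<close> is symmetric.\<close>

lemma opposite_signs_quadruple:
  fixes a b c d :: real
  assumes "a < 0 \<or> b < 0 \<or> d < 0 \<longleftrightarrow> 0 < a \<or> 0 < b \<or> 0 < d"
    and "a < 0 \<or> c < 0 \<or> d < 0 \<longleftrightarrow> 0 < a \<or> 0 < c \<or> 0 < d"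
    and "b < 0 \<or> c < 0 \<or> d < 0 \<longleftrightarrow> 0 < b \<or> 0 < c \<or> 0 < d"
    and "0 \<le> a \<Longrightarrow> b < 0 \<or> c < 0 \<Longrightarrow> 0 < b \<or> 0 < c" "a \<le> 0 \<Longrightarrow> 0 < b \<or> 0 < c \<Longrightarrow> b < 0 \<or> c < 0"
    and "0 \<le> b \<Longrightarrow> a < 0 \<or> c < 0 \<Longrightarrow> 0 < a \<or> 0 < c" "b \<le> 0 \<Longrightarrow> 0 < a \<or> 0 < c \<Longrightarrow> a < 0 \<or> c < 0"
    and "0 \<le> c \<Longrightarrow> a < 0 \<or> b < 0 \<Longrightarrow> 0 < a \<or> 0 < b" "c \<le> 0 \<Longrightarrow> 0 < a \<or> 0 < b \<Longrightarrow> a < 0 \<or> b < 0"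
    and "a < 0 \<or> b < 0 \<or> c < 0 \<longleftrightarrow> 0 < a \<or> 0 < b \<or> 0 < c"
  shows "d = 0"
  using assms by (smt (verit))

lemma corank_G_10_26:
  assumes "M \<in> cdv_matrices G_10_26"
  shows "kernel_dim M \<le> 5"
proof (rule ccontr)
  assume "\<not> kernel_dim M \<le> 5"
  then have "card {1, 2, 3, 4, 6 :: nat} < kernel_dim M" by simp
  note M = cdv_matricesD[OF assms G_10_26_props(2)]
  from kernel_vector_vanishing_on[OF M(1) _ _ \<open>card _ < _\<close>]
  obtain x where x: "x \<in> carrier_vec 10" "x \<noteq> 0\<^sub>v 10" "M *\<^sub>v x = 0\<^sub>v 10"
    and zero: "\<And>s. s \<in> {1, 2, 3, 4, 6 :: nat} \<Longrightarrow> x $ s = 0"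
    by auto
  note signs = kernel_vector_signs[OF M(1,3) x(1,3)]
  have z: "x $ 1 = 0" "x $ 2 = 0" "x $ 3 = 0" "x $ 4 = 0" "x $ 6 = 0"
    using zero by auto
  have x5: "x $ 5 = 0" using signs[of 6] z by (auto simp: nbrs_G_10_26)
  note z = z x5
  have x9: "x $ 9 \<noteq> 0"
  proof
    assume "x $ 9 = 0"
    then have "x = 0\<^sub>v 10"
      using z opposite_signs_triangle[of "x $ 0" "x $ 7" "x $ 8"] signs[of 1] signs[of 4] signs[of 5]
      by (simp add: vec_eq_0_iff[OF x(1)] all_less_10 nbrs_G_10_26 del: One_nat_def)
    with x(2) show False by simp
  qed
  have entry: "M $$ (i, j) = 0 \<longleftrightarrow> j \<notin> nbrs G_10_26 i" if "i < 10" "j < 10" "i \<noteq> j" for i j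
  proof -
    have "if j \<in> nbrs G_10_26 i then M $$ (i, j) < 0 else M $$ (i, j) = 0"
      using M(3) that by (simp add: cdv_pattern_iff_nbrs)
    then show ?thesis by (auto split: if_splits)
  qed
  \<comment> \<open>All neighbours of index 9 carry zeros, so only the diagonal term of row 9
    survives.\<close>
  have "M $$ (9, 9) * x $ 9 = 0"
    using kernel_vector_row[OF M(1) x(1,3), of 9] z entry[of 9 0] entry[of 9 7] entry[of 9 8]
    by (simp add: sum_less_10 nbrs_G_10_26 del: One_nat_def)
  with x9 have "M $$ (9, 9) = 0" by simp
  note diag = one_negative_eigenvalue_isotropic[OF M(1,2,4) _ _ _ this]
  \<comment> \<open>With \<open>w = 9\<close>, each of 0, 7, 8 needs a neighbour \<open>u\<close> of
    9 that is not adjacent to it: 5, 4 and 1 respectively.\<close>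
  have "0 \<le> M $$ (0, 0)" "0 \<le> M $$ (7, 7)" "0 \<le> M $$ (8, 8)"
    using diag[of 5 0] diag[of 4 7] diag[of 1 8] by (simp_all add: entry nbrs_G_10_26)
  then have diag_nonneg: "0 \<le> M $$ (v, v)" if "v \<in> {0, 7, 8}" for v
    using that by auto
  have nbrs: "v < 10" "nbrs G_10_26 v \<subseteq> {..<10} - {v}" if "v \<in> {0, 7, 8}" for v
    using that by (auto simp: nbrs_G_10_26)
  have pos: "\<exists>u \<in> nbrs G_10_26 v. 0 < x $ u"
    if v: "v \<in> {0, 7, 8}" and "0 \<le> x $ v" "\<exists>u \<in> nbrs G_10_26 v. x $ u < 0" for v
    using kernel_vector_positive_neighbour[OF M(1,3) x(1,3) nbrs[OF v]] diag_nonneg[OF v] that(2,3)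
    by (meson mult_nonneg_nonneg)
  have neg: "\<exists>u \<in> nbrs G_10_26 v. x $ u < 0"
    if v: "v \<in> {0, 7, 8}" and "x $ v \<le> 0" "\<exists>u \<in> nbrs G_10_26 v. 0 < x $ u" for v
    using kernel_vector_negative_neighbour[OF M(1,3) x(1,3) nbrs[OF v]] diag_nonneg[OF v] that(2,3)
    by (meson mult_nonneg_nonpos)
  have "x $ 9 = 0"
  \<comment> \<open>Here \<open>d\<close> is the entry at 9 and \<open>c\<close> the entry at 8. The
    indices 0, 7, 8 are mutually adjacent, and their nonnegative diagonal entries provide the
    one-sided conditions.\<close>
  proof (rule opposite_signs_quadruple[of "x $ 0" "x $ 7" "x $ 9" "x $ 8"])
    show "x $ 0 < 0 \<or> x $ 7 < 0 \<or> x $ 9 < 0 \<longleftrightarrow> 0 < x $ 0 \<or> 0 < x $ 7 \<or> 0 < x $ 9"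
      using signs[of 1] z by (simp add: nbrs_G_10_26 del: One_nat_def)
    show "x $ 0 < 0 \<or> x $ 8 < 0 \<or> x $ 9 < 0 \<longleftrightarrow> 0 < x $ 0 \<or> 0 < x $ 8 \<or> 0 < x $ 9"
      using signs[of 4] z by (simp add: nbrs_G_10_26 del: One_nat_def)
    show "x $ 7 < 0 \<or> x $ 8 < 0 \<or> x $ 9 < 0 \<longleftrightarrow> 0 < x $ 7 \<or> 0 < x $ 8 \<or> 0 < x $ 9"
      using signs[of 5] z by (simp add: nbrs_G_10_26 del: One_nat_def)
    show "x $ 0 < 0 \<or> x $ 7 < 0 \<or> x $ 8 < 0 \<longleftrightarrow> 0 < x $ 0 \<or> 0 < x $ 7 \<or> 0 < x $ 8"
      using signs[of 3] z by (simp add: nbrs_G_10_26 del: One_nat_def)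
  qed (use pos[of 0] pos[of 7] pos[of 8] neg[of 0] neg[of 7] neg[of 8] z in
      \<open>simp_all add: nbrs_G_10_26 del: One_nat_def\<close>)
  with x9 show False by simp
qed

section \<open>Lower bounds: Gram matrices for a Lorentzian form\<close>

text \<open>For \<open>c > 0\<close> this is a Gram matrix for a form of signature
  \<open>(m, 1)\<close>, with \<open>m\<close> the index of the negative coordinate. The weight
  \<open>c\<close> allows a rescaled last coordinate, such as by the square root of 2, while the
  vectors keep integer entries.\<close>

definition lorentz_mat :: "nat \<Rightarrow> nat \<Rightarrow> real \<Rightarrow> (nat \<Rightarrow> nat \<Rightarrow> real) \<Rightarrow> real mat" where
  "lorentz_mat n m c V =
    mat n n (\<lambda>(i, j). (\<Sum>a<m. V i a * V j a) - c * V i m * V j m)"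

lemma lorentz_mat_carrier: "lorentz_mat n m c V \<in> carrier_mat n n"
  by (simp add: lorentz_mat_def)

lemma transpose_lorentz_mat: "transpose_mat (lorentz_mat n m c V) = lorentz_mat n m c V"
  by (rule eq_matI) (auto simp: lorentz_mat_def mult_ac)

lemma lorentz_mat_quadratic_form:
  assumes "x \<in> carrier_vec n"
  shows "x \<bullet> (lorentz_mat n m c V *\<^sub>v x) =
    (\<Sum>a<m. (\<Sum>i<n. V i a * x $ i)\<^sup>2) - c * (\<Sum>i<n. V i m * x $ i)\<^sup>2"
proof -
  have sq: "(\<Sum>i<n. V i a * x $ i)\<^sup>2 = (\<Sum>i<n. \<Sum>j<n. x $ i * (V i a * V j a) * x $ j)" for a
    unfolding power2_eq_square sum_product by (intro sum.cong refl) (simp add: mult_ac)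
  have "x \<bullet> (lorentz_mat n m c V *\<^sub>v x) = (\<Sum>i<n. \<Sum>j<n.
      (\<Sum>a<m. x $ i * (V i a * V j a) * x $ j) - c * (x $ i * (V i m * V j m) * x $ j))"
    unfolding quadratic_form_sum[OF lorentz_mat_carrier assms assms]
    by (intro sum.cong refl) (simp add: lorentz_mat_def algebra_simps sum_distrib_left sum_distrib_right)
  also have "\<dots> = (\<Sum>i<n. \<Sum>j<n. \<Sum>a<m. x $ i * (V i a * V j a) * x $ j) -
      c * (\<Sum>i<n. V i m * x $ i)\<^sup>2"
    unfolding sq by (simp add: sum_subtractf sum_distrib_left)
  also have "(\<Sum>i<n. \<Sum>j<n. \<Sum>a<m. x $ i * (V i a * V j a) * x $ j) =
      (\<Sum>a<m. (\<Sum>i<n. V i a * x $ i)\<^sup>2)"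
    unfolding sq by (simp add: sum.swap[of _ "{..<m}"])
  finally show ?thesis .
qed

text \<open>On the hyperplane given by the last coordinates of the vectors, the subtracted square
  vanishes and a sum of squares remains. The diagonal entry at \<open>v\<close> supplies a negative
  vector.\<close>

lemma one_negative_eigenvalue_lorentz_mat:
  assumes "v < n" "lorentz_mat n m c V $$ (v, v) < 0"
  shows "one_negative_eigenvalue (lorentz_mat n m c V)"
proof (rule one_negative_eigenvalueI[OF lorentz_mat_carrier transpose_lorentz_mat])
  show "unit_vec n v \<bullet> (lorentz_mat n m c V *\<^sub>v unit_vec n v) < 0"
    using assms lorentz_mat_carrier[of n m c V] by simp
  show "0 \<le> z \<bullet> (lorentz_mat n m c V *\<^sub>v z)"
    if z: "z \<in> carrier_vec n" "vec n (\<lambda>i. V i m) \<bullet> z = 0" for z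
  proof -
    have "(\<Sum>i<n. V i m * z $ i) = 0"
      using z by (simp add: scalar_prod_def atLeast0LessThan)
    then show ?thesis
      unfolding lorentz_mat_quadratic_form[OF z(1)] by (simp add: sum_nonneg)
  qed
qed auto

text \<open>The matrix factors through dimension \<open>Suc m\<close>, with sign and weight absorbed
  in the left factor. Both \<open>n = 10, m = 4\<close> and \<open>n = 11, m = 5\<close> give corank
  at least 5.\<close>

lemma kernel_dim_lorentz_mat_ge: "n - Suc m \<le> kernel_dim (lorentz_mat n m c V)"
proof -
  let ?U = "mat n (Suc m) (\<lambda>(i, a). (if a = m then - c else 1) * V i a)"
  let ?W = "mat (Suc m) n (\<lambda>(a, i). V i a)"
  have "lorentz_mat n m c V = ?U * ?W"
    by (rule eq_matI) (auto simp: lorentz_mat_def scalar_prod_def atLeast0LessThan)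
  then show ?thesis
    using kernel_dim_ge[of ?W "Suc m" n] kernel_dim_mult_le[of ?U n "Suc m" ?W n] by simp
qed

text \<open>
  Column \<open>j\<close> of \<open>X\<close> vanishes if the columns of \<open>M\<close> belonging to the non-neighbours of \<open>j\<close> are
  linearly independent. Where this fails, \<open>j\<close> is put into \<open>T\<close>: once the columns outside \<open>T\<close> are
  known to vanish, symmetry of \<open>X\<close> leaves only non-neighbours in \<open>T\<close> to consider.
\<close>

lemma strong_arnold_columnwise:
  assumes M: "M \<in> carrier_mat n n" and sym: "transpose_mat M = M"
    and inj: "\<And>j y. j < n \<Longrightarrow> y \<in> carrier_vec n \<Longrightarrow> M *\<^sub>v y = 0\<^sub>v n \<Longrightarrow>
      (\<And>k. k < n \<Longrightarrow> k = j \<or> M $$ (j, k) \<noteq> 0 \<or> j \<in> T \<and> k \<notin> T \<Longrightarrow> y $ k = 0) \<Longrightarrow> y = 0\<^sub>v n"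
  shows "strong_arnold n M"
  unfolding strong_arnold_def
proof (rule notI, elim bexE conjE)
  fix X assume X: "X \<in> carrier_mat n n" "X \<noteq> 0\<^sub>m n n" "transpose_mat X = X" "M * X = 0\<^sub>m n n"
    and zero: "\<forall>i<n. \<forall>j<n. i = j \<or> M $$ (i, j) \<noteq> 0 \<longrightarrow> X $$ (i, j) = 0"
  have symX: "X $$ (i, j) = X $$ (j, i)" if "i < n" "j < n" for i j
    using arg_cong[OF X(3), of "\<lambda>Y. Y $$ (i, j)"] X(1) that by simp
  have col: "col X j = 0\<^sub>v n"
    if j: "j < n" and T: "\<And>k. k < n \<Longrightarrow> j \<in> T \<Longrightarrow> k \<notin> T \<Longrightarrow> X $$ (k, j) = 0" for j
  proof (rule inj[OF j])
    show "col X j \<in> carrier_vec n" using X(1) j by auto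
    show "M *\<^sub>v col X j = 0\<^sub>v n"
      using X(4) j by (simp flip: col_mult2[OF M X(1)])
    fix k assume k: "k < n" "k = j \<or> M $$ (j, k) \<noteq> 0 \<or> j \<in> T \<and> k \<notin> T"
    then have "X $$ (k, j) = 0"
      using zero T symX[OF k(1) j] j by metis
    then show "col X j $ k = 0" using X(1) j k(1) by simp
  qed
  have free: "X $$ (k, j) = 0" if "k < n" "j < n" "j \<notin> T" for k j
    using arg_cong[OF col[OF that(2)], of "\<lambda>y. y $ k"] X(1) that by simp
  have "X $$ (k, j) = 0" if "k < n" "j < n" for k j
  proof -
    have "col X j = 0\<^sub>v n"
      using symX[OF _ that(2)] free[OF that(2)] that(2) by (intro col) auto
    from arg_cong[OF this, of "\<lambda>y. y $ k"] show ?thesis using X(1) that by simp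
  qed
  then have "X = 0\<^sub>m n n" using X(1) by (intro eq_matI) auto
  with X(2) show False by simp
qed

text \<open>Membership is reduced to finitely many numerical checks; the strong Arnold condition is
  phrased by explicit sums and neighbourhoods, so that it becomes a family of homogeneous linear
  systems.\<close>

lemma lorentz_mat_in_cdv_matricesI:
  assumes V: "card (pverts G) = n" and pat: "cdv_pattern G n (lorentz_mat n m c V)"
    and neg: "v < n" "lorentz_mat n m c V $$ (v, v) < 0"
    and inj: "\<And>j y. j < n \<Longrightarrow> y \<in> carrier_vec n \<Longrightarrow>
      \<forall>i<n. (\<Sum>k<n. lorentz_mat n m c V $$ (i, k) * y $ k) = 0 \<Longrightarrow>
      \<forall>k<n. k = j \<or> k \<in> nbrs G j \<or> j \<in> T \<and> k \<notin> T \<longrightarrow> y $ k = 0 \<Longrightarrow> \<forall>k<n. y $ k = 0"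
  shows "lorentz_mat n m c V \<in> cdv_matrices G"
proof -
  let ?M = "lorentz_mat n m c V"
  note M = lorentz_mat_carrier[of n m c V]
  have "strong_arnold n ?M"
  proof (rule strong_arnold_columnwise[OF M transpose_lorentz_mat, of T])
    fix j y
    assume y: "j < n" "y \<in> carrier_vec n" "?M *\<^sub>v y = 0\<^sub>v n"
      and zero: "\<And>k. k < n \<Longrightarrow> k = j \<or> ?M $$ (j, k) \<noteq> 0 \<or> j \<in> T \<and> k \<notin> T \<Longrightarrow> y $ k = 0"
    have "?M $$ (j, k) < 0" if "k < n" "k \<noteq> j" "k \<in> nbrs G j" for k
      using pat y(1) that by (simp add: cdv_pattern_iff_nbrs)
    then have "\<forall>k<n. k = j \<or> k \<in> nbrs G j \<or> j \<in> T \<and> k \<notin> T \<longrightarrow> y $ k = 0"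
      using zero by (metis less_irrefl)
    then show "y = 0\<^sub>v n"
      unfolding vec_eq_0_iff[OF y(2)] using kernel_vector_row[OF M y(2,3)] y(1,2)
      by (intro inj[of j]) auto
  qed
  then show ?thesis
    using V M pat one_negative_eigenvalue_lorentz_mat[of v n m c V] neg
    by (simp add: cdv_matrices_def transpose_lorentz_mat)
qed

lemma colin_de_verdiere_eqI:
  assumes "M \<in> cdv_matrices G" "k \<le> kernel_dim M" "\<And>N. N \<in> cdv_matrices G \<Longrightarrow> kernel_dim N \<le> k"
  shows "colin_de_verdiere G = k"
  unfolding colin_de_verdiere_def
  using assms by (intro Max_eqI finite_cdv_coranks) (auto intro!: image_eqI[of _ _ M] le_antisym)

section \<open>Explicit vectors for the three graphs\<close>

lemma sum_less_4: "sum f {..<4} = f 0 + f 1 + f 2 + f (3 :: nat)"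
  by (simp add: numeral_eq_Suc)

lemma sum_less_5: "sum f {..<5} = f 0 + f 1 + f 2 + f 3 + f (4 :: nat)"
  by (simp add: numeral_eq_Suc)

lemma lorentz_mat_entry:
  "i < n \<Longrightarrow> j < n \<Longrightarrow>
    lorentz_mat n m c V $$ (i, j) = (\<Sum>a<m. V i a * V j a) - c * V i m * V j m"
  by (simp add: lorentz_mat_def)

text \<open>
  The vectors for the three graphs come from a computer search that starts from unit vectors at
  three (in \<open>G\<^bsub>11,35\<^esub>\<close>: two) pairwise non-adjacent vertices.
\<close>

definition gram_vectors_10_30 :: "nat \<Rightarrow> nat \<Rightarrow> real" where
  "gram_vectors_10_30 i a =
    [[0, - 3, - 3, - 1, 2], [1, 0, 0, 0, 0], [- 3, - 1, - 1, - 2, 2], [- 2, - 2, - 1, 1, 2],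
     [- 1, - 1, 0, 0, 1], [- 1, - 1, - 2, 1, 2], [- 3, 0, - 1, 1, 2], [0, 1, 0, 0, 0],
     [0, 0, 1, 0, 0], [- 1, - 1, - 2, 2, 2]] ! i ! a"

lemma lorentz_mat_G_10_30: "lorentz_mat 10 4 2 gram_vectors_10_30 \<in> cdv_matrices G_10_30"
proof (rule lorentz_mat_in_cdv_matricesI[OF G_10_30_props(2), where T = "{}"])
  let ?M = "lorentz_mat 10 4 2 gram_vectors_10_30"
  show "cdv_pattern G_10_30 10 ?M"
    by (simp add: cdv_pattern_iff_nbrs all_less_10 sum_less_10 nbrs_G_10_30[unfolded One_nat_def]
        lorentz_mat_entry sum_less_4 gram_vectors_10_30_def)
  \<comment> \<open>The vector at index 5 has form value
    \<open>1 + 1 + 4 + 1 - 2 * 4 = - 1\<close>.\<close>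
  show "(5 :: nat) < 10" "?M $$ (5, 5) < 0"
    by (simp_all add: lorentz_mat_entry sum_less_4 gram_vectors_10_30_def)
  fix j y
  assume j: "j < 10" and y: "\<forall>i<10. (\<Sum>k<10. ?M $$ (i, k) * y $ k) = 0"
    and zero: "\<forall>k<10. k = j \<or> k \<in> nbrs G_10_30 j \<or> j \<in> {} \<and> k \<notin> {} \<longrightarrow> y $ k = 0"
  \<comment> \<open>These rows of \<open>?M\<close> span its row space; likewise for the other two graphs.\<close>
  note rows = y[rule_format, of 0] y[rule_format, of 3] y[rule_format, of 4] y[rule_format, of 7] y[rule_format, of 8]
  note rows = rows[simplified sum_less_10 lorentz_mat_entry sum_less_4
    gram_vectors_10_30_def, simplified]
  \<comment> \<open>Quantifying over \<open>j\<close> again unfolds into ten cases; in each, the row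
    equations restricted to the non-neighbours of \<open>j\<close> have only the zero
    solution.\<close>
  have "\<forall>j<10. (\<forall>k<10. k = j \<or> k \<in> nbrs G_10_30 j \<or> j \<in> {} \<and> k \<notin> {} \<longrightarrow> y $ k = 0)
      \<longrightarrow> (\<forall>k<10. y $ k = 0)"
    by (simp add: all_less_10 nbrs_G_10_30[unfolded One_nat_def]; insert rows;
      intro conjI impI; linarith)
  with j zero show "\<forall>k<10. y $ k = 0" by blast
qed

definition gram_vectors_10_26 :: "nat \<Rightarrow> nat \<Rightarrow> real" where
  "gram_vectors_10_26 i a =
    [[0, - 1, 0, 0, 1], [- 1, - 1, - 1, - 1, 2], [- 1, - 1, - 1, - 1, 2], [0, - 1, 0, 0, 2],
     [- 2, 0, - 1, - 1, 2], [- 1, - 1, - 1, 1, 1], [1, 0, 0, 0, 0], [0, 1, 0, 0, 0],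
     [0, - 1, 0, - 3, 2], [0, 0, 1, 0, 0]] ! i ! a"

text \<open>The vectors at 1 and 2 coincide, and those at 0, 3, 7 span only a plane.
  \<open>T\<close> collects the indices whose non-neighbours include one of these dependent
  families: 4, 5, 8 for the first, 6 and 9 for the second.\<close>

lemma lorentz_mat_G_10_26: "lorentz_mat 10 4 1 gram_vectors_10_26 \<in> cdv_matrices G_10_26"
proof (rule lorentz_mat_in_cdv_matricesI[OF G_10_26_props(2), where T = "{4, 5, 6, 8, 9}"])
  let ?M = "lorentz_mat 10 4 1 gram_vectors_10_26"
  show "cdv_pattern G_10_26 10 ?M"
    by (simp add: cdv_pattern_iff_nbrs all_less_10 sum_less_10 nbrs_G_10_26[unfolded One_nat_def]
        lorentz_mat_entry sum_less_4 gram_vectors_10_26_def)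
  show "(3 :: nat) < 10" "?M $$ (3, 3) < 0"
    by (simp_all add: lorentz_mat_entry sum_less_4 gram_vectors_10_26_def)
  fix j y
  assume j: "j < 10" and y: "\<forall>i<10. (\<Sum>k<10. ?M $$ (i, k) * y $ k) = 0"
    and zero: "\<forall>k<10. k = j \<or> k \<in> nbrs G_10_26 j \<or> j \<in> {4, 5, 6, 8, 9} \<and> k \<notin> {4, 5, 6, 8, 9} \<longrightarrow> y $ k = 0"
  note rows = y[rule_format, of 0] y[rule_format, of 1] y[rule_format, of 5] y[rule_format, of 6] y[rule_format, of 9]
  note rows = rows[simplified sum_less_10 lorentz_mat_entry sum_less_4
    gram_vectors_10_26_def, simplified]
  have "\<forall>j<10. (\<forall>k<10. k = j \<or> k \<in> nbrs G_10_26 j \<or> j \<in> {4, 5, 6, 8, 9} \<and> k \<notin> {4, 5, 6, 8, 9} \<longrightarrow> y $ k = 0)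
      \<longrightarrow> (\<forall>k<10. y $ k = 0)"
    by (simp add: all_less_10 nbrs_G_10_26[unfolded One_nat_def]; insert rows;
      intro conjI impI; linarith)
  with j zero show "\<forall>k<10. y $ k = 0" by blast
qed

definition gram_vectors_11_35 :: "nat \<Rightarrow> nat \<Rightarrow> real" where
  "gram_vectors_11_35 i a =
    [[0, 0, 0, - 1, 1, 1], [0, 0, 1, 0, - 1, 0], [- 1, - 1, - 2, 0, - 1, 3], [0, - 2, - 1, 0, 0, 2],
     [- 1, - 1, - 1, 2, - 1, 2], [- 1, - 1, 1, 0, 1, 1], [1, 0, 0, 0, 0, 0], [0, 0, - 1, 1, 1, 1],
     [0, 0, - 1, - 1, - 1, 1], [0, 1, 0, 0, 0, 0], [- 1, - 1, - 2, - 1, 1, 2]] ! i ! a"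

text \<open>Index 6 has six non-neighbours, whose vectors lie in the five-dimensional space
  orthogonal to the vector at 6 and are therefore dependent. With \<open>T = {6}\<close>, column 6
  is settled by symmetry from the other columns.\<close>

lemma lorentz_mat_G_11_35: "lorentz_mat 11 5 1 gram_vectors_11_35 \<in> cdv_matrices G_11_35"
proof (rule lorentz_mat_in_cdv_matricesI[OF G_11_35_props(2), where T = "{6}"])
  let ?M = "lorentz_mat 11 5 1 gram_vectors_11_35"
  show "cdv_pattern G_11_35 11 ?M"
    by (simp add: cdv_pattern_iff_nbrs all_less_11 all_less_10 sum_less_11 sum_less_10 nbrs_G_11_35[unfolded One_nat_def]
        lorentz_mat_entry sum_less_5 gram_vectors_11_35_def)
  show "(2 :: nat) < 11" "?M $$ (2, 2) < 0"
    by (simp_all add: lorentz_mat_entry sum_less_5 gram_vectors_11_35_def)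
  fix j y
  assume j: "j < 11" and y: "\<forall>i<11. (\<Sum>k<11. ?M $$ (i, k) * y $ k) = 0"
    and zero: "\<forall>k<11. k = j \<or> k \<in> nbrs G_11_35 j \<or> j \<in> {6} \<and> k \<notin> {6} \<longrightarrow> y $ k = 0"
  note rows = y[rule_format, of 1] y[rule_format, of 6] y[rule_format, of 7] y[rule_format, of 8]
    y[rule_format, of 9] y[rule_format, of 10]
  note rows = rows[simplified sum_less_11 sum_less_10 lorentz_mat_entry sum_less_5
    gram_vectors_11_35_def, simplified]
  have "\<forall>j<11. (\<forall>k<11. k = j \<or> k \<in> nbrs G_11_35 j \<or> j \<in> {6} \<and> k \<notin> {6} \<longrightarrow> y $ k = 0)
      \<longrightarrow> (\<forall>k<11. y $ k = 0)"
    by (simp add: all_less_11 all_less_10 nbrs_G_11_35[unfolded One_nat_def]; insert rows;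
      intro conjI impI; linarith)
  with j zero show "\<forall>k<11. y $ k = 0" by blast
qed

theorem mainTheorem5:
  shows "colin_de_verdiere G_11_35 = 5 \<and> colin_de_verdiere G_10_30 = 5 \<and>
    colin_de_verdiere G_10_26 = 5"
proof (intro conjI)
  show "colin_de_verdiere G_11_35 = 5"
    using colin_de_verdiere_eqI[OF lorentz_mat_G_11_35 _ corank_G_11_35]
      kernel_dim_lorentz_mat_ge[of 11 5 1 gram_vectors_11_35] by simp
  show "colin_de_verdiere G_10_30 = 5"
    using colin_de_verdiere_eqI[OF lorentz_mat_G_10_30 _ corank_G_10_30]
      kernel_dim_lorentz_mat_ge[of 10 4 2 gram_vectors_10_30] by simp
  show "colin_de_verdiere G_10_26 = 5"
    using colin_de_verdiere_eqI[OF lorentz_mat_G_10_26 _ corank_G_10_26]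
      kernel_dim_lorentz_mat_ge[of 10 4 1 gram_vectors_10_26] by simp
qed

end
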